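(* Let $X$ be a real-valued random variable with distribution function $F$. The mixed Poisson distribution $Poi\bigwedge F$ exists if and only if $X$ has a bilateral Laplace-Stieltjes transform $\mathcal{L}_X(t)$ that is completely monotone for $t\in[0,1]$, in the following sense: (i) $\mathcal{L}_X(t)$ is (finite and) continuous for $t\in[0,1]$; (ii) for all $k\in\mathbb{N}_0$, the derivatives $\mathcal{L}_X^{(k)}(t)$ are finite and satisfy $(-1)^k\mathcal{L}_X^{(k)}(t)\geq 0$ for $t\in(0,1)$.
   Context: Notation: $\mathbb{N}_0=\{0,1,2,\dots\}$. The bilateral Laplace-Stieltjes transform (BLT) of a real-valued random variable $X$ with distribution function $F$ (not assumed nonnegative, nor to have a density) is $\mathcal{L}_X(t)=\mathbb{E}[\exp(-tX)]=\int_{-\infty}^\infty \exp(-tx)\,dF(x)$. A function $f$ on $\mathbb{N}_0$ is a valid probability mass function (PMF) if $f(n)\geq 0$ for all $n\in\mathbb{N}_0$ and $\sum_{n=0}^\infty f(n)=1$. For a real-valued random variable $X\sim F$, the mixed Poisson distribution generated by $F$, denoted $Poi\bigwedge F$, is the distribution on $\mathbb{N}_0$ with PMF $f(n)=\mathbb{E}\left[X^n e^{-X}\right]/n!$, provided this $f$ is a valid PMF (in particular each expectation must be well defined and finite). The mixed Poisson distribution $Poi\bigwedge F$ is said to exist if this $f$ is a valid PMF. *)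

theory Defs
  imports "HOL-Probability.Probability"
begin

definition valid_pmf :: "(nat \<Rightarrow> real) \<Rightarrow> bool" where
  "valid_pmf f \<longleftrightarrow> (\<forall>n. 0 \<le> f n) \<and> f sums 1"

definition mixed_poisson_mass :: "'a measure \<Rightarrow> ('a \<Rightarrow> real) \<Rightarrow> nat \<Rightarrow> real" where
  "mixed_poisson_mass M X n = (\<integral>\<omega>. X \<omega> ^ n * exp (- X \<omega>) \<partial>M) / fact n"

(* The Bochner integral is 0 for non-integrable functions, so that finiteness of the
   expectations has to be required separately, here and in has_blt_at. *)
definition mixed_poisson_exists :: "'a measure \<Rightarrow> ('a \<Rightarrow> real) \<Rightarrow> bool" where
  "mixed_poisson_exists M X \<longleftrightarrow>
     (\<forall>n. integrable M (\<lambda>\<omega>. X \<omega> ^ n * exp (- X \<omega>))) \<and> valid_pmf (mixed_poisson_mass M X)"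

definition blt :: "'a measure \<Rightarrow> ('a \<Rightarrow> real) \<Rightarrow> real \<Rightarrow> real" where
  "blt M X t = (\<integral>\<omega>. exp (- t * X \<omega>) \<partial>M)"

definition has_blt_at :: "'a measure \<Rightarrow> ('a \<Rightarrow> real) \<Rightarrow> real \<Rightarrow> bool" where
  "has_blt_at M X t \<longleftrightarrow> integrable M (\<lambda>\<omega>. exp (- t * X \<omega>))"

(* Differentiability of the k-th iterated derivative, for every k, says that the derivatives
   of all orders exist and are finite; deriv by itself is total. *)
definition completely_monotone_unit :: "(real \<Rightarrow> real) \<Rightarrow> bool" where
  "completely_monotone_unit L \<longleftrightarrow>
     continuous_on {0..1} L \<and>
     (\<forall>k. \<forall>t\<in>{0<..<1}. (deriv ^^ k) L differentiable (at t) \<and> 0 \<le> (-1) ^ k * (deriv ^^ k) L t)"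

(* The mixed Poisson distribution and the transform depend on X only through its
   distribution function F. *)
lemma (in prob_space) interval_measure_cdf_distr:
  assumes "random_variable borel X"
  shows "interval_measure (cdf (distr M borel X)) = distr M borel X"
proof -
  interpret D: real_distribution "distr M borel X"
    using assms by simp
  have "real_distribution (interval_measure (cdf (distr M borel X)))"
    by (rule real_distribution_interval_measure)
       (auto intro: D.cdf_nondecreasing D.cdf_is_right_cont D.cdf_lim_at_bot D.cdf_lim_at_top_prob)
  moreover have "cdf (interval_measure (cdf (distr M borel X))) = cdf (distr M borel X)"
    by (rule cdf_interval_measure)
       (auto intro: D.cdf_nondecreasing D.cdf_is_right_cont D.cdf_lim_at_bot D.cdf_lim_at_top_prob)
  ultimately show ?thesis
    using cdf_unique D.real_distribution_axioms by blast
qed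

lemma (in prob_space) mixed_poisson_exists_iff_cdf:
  assumes "random_variable borel X"
  shows "mixed_poisson_exists M X \<longleftrightarrow>
    mixed_poisson_exists (interval_measure (cdf (distr M borel X))) (\<lambda>x. x)"
proof -
  have "integrable (distr M borel X) (\<lambda>x. x ^ n * exp (- x)) \<longleftrightarrow>
      integrable M (\<lambda>\<omega>. X \<omega> ^ n * exp (- X \<omega>))" for n
    using assms by (intro integrable_distr_eq) auto
  moreover have "(\<integral>x. x ^ n * exp (- x) \<partial>distr M borel X) = (\<integral>\<omega>. X \<omega> ^ n * exp (- X \<omega>) \<partial>M)" for n
    using assms by (intro integral_distr) auto
  ultimately show ?thesis
    unfolding interval_measure_cdf_distr[OF assms] mixed_poisson_exists_def valid_pmf_def
      mixed_poisson_mass_def by simp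
qed

lemma (in prob_space) blt_eq_cdf:
  assumes "random_variable borel X"
  shows "has_blt_at M X t \<longleftrightarrow>
      integrable (interval_measure (cdf (distr M borel X))) (\<lambda>x. exp (- t * x))"
    and "blt M X t = (\<integral>x. exp (- t * x) \<partial>interval_measure (cdf (distr M borel X)))"
  unfolding interval_measure_cdf_distr[OF assms] has_blt_at_def blt_def
  using assms by (auto intro!: integrable_distr_eq[symmetric] integral_distr[symmetric])

end

theory Submission
  imports Defs "HOL-Real_Asymp.Real_Asymp"
begin

text \<open>Once \<open>E exp (- X)\<close> is finite, the transform \<open>L\<close> is automatically finite and continuous on
  \<open>[0,1]\<close> and smooth on \<open>(0,1)\<close>, with \<open>(-1)^k L^(k)(t) = E X^k exp (- t X)\<close>. Complete monotonicity
  thus means that these moments are nonnegative for \<open>0 < t < 1\<close>. If the mass function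
  \<open>p n = E X^n exp (- X) / n!\<close> is bounded by 1, then the absolute moments of the measure
  \<open>exp (- X) dP\<close> grow like \<open>n!\<close>, so that the exponential series may be integrated termwise and
  \<open>E X^k exp (- t X)\<close> is a power series in \<open>1 - t\<close> with coefficients \<open>(n + k)! p (n + k) / n!\<close>.
  This settles the forward direction. Conversely, Taylor expansion of \<open>L\<close> with nonnegative
  remainder from a point near 1 to a point near 0 gives \<open>p 0 + ... + p n \<le> L 0 = 1\<close>; hence
  \<open>L(t)\<close> is the power series of the \<open>p n\<close> in \<open>1 - t\<close>, and \<open>t \<rightarrow> 0\<close> shows that they sum to 1.\<close>

section \<open>Elementary bounds for exponentials and two convergence criteria\<close>

lemma power_over_fact_le_exp:
  fixes x :: real
  assumes "0 \<le> x"
  shows "x ^ n / fact n \<le> exp x"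
proof -
  have "x ^ n / fact n \<le> (\<Sum>i\<le>n. x ^ i / fact i)"
    by (rule member_le_sum) (use assms in auto)
  also have "\<dots> \<le> exp x"
    using assms summable_exp_generic[of x]
    by (auto simp: exp_def divide_inverse ac_simps intro!: sum_le_suminf)
  finally show ?thesis .
qed

text \<open>The exponential is monotone in \<open>t\<close>, with a direction given by the sign of
  \<open>x\<close>, so one of the two endpoints always dominates. The sum avoids a case split on the
  sign of \<open>X\<close> in every later majorant.\<close>

lemma exp_between_le:
  fixes a b t x :: real
  assumes "a \<le> t" "t \<le> b"
  shows "exp (- t * x) \<le> exp (- a * x) + exp (- b * x)"
proof (cases "0 \<le> x")
  case True
  then have "exp (- t * x) \<le> exp (- a * x)"
    using assms by (simp add: mult_right_mono)
  then show ?thesis by (simp add: add_increasing2)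
next
  case False
  then have "exp (- t * x) \<le> exp (- b * x)"
    using assms by (simp add: mult_right_mono_neg)
  then show ?thesis by (simp add: add_increasing)
qed

text \<open>Mean value inequality in the exponent. The factor in front of
  \<open>\<bar>s - t\<bar>\<close> is free of \<open>s\<close> and \<open>t\<close>, so it majorizes
  all difference quotients at once.\<close>

lemma exp_diff_le:
  fixes a b s t x :: real
  assumes "s \<in> {a..b}" "t \<in> {a..b}"
  shows "\<bar>exp (- s * x) - exp (- t * x)\<bar> \<le> \<bar>x\<bar> * (exp (- a * x) + exp (- b * x)) * \<bar>s - t\<bar>"
proof -
  have "norm (exp (- s * x) - exp (- t * x))
      \<le> (\<bar>x\<bar> * (exp (- a * x) + exp (- b * x))) * norm (s - t)"
  proof (rule field_differentiable_bound[where S = "{a..b}"])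
    fix r :: real assume r: "r \<in> {a..b}"
    show "((\<lambda>r. exp (- r * x)) has_field_derivative - x * exp (- r * x)) (at r within {a..b})"
      by (auto intro!: derivative_eq_intros)
    show "norm (- x * exp (- r * x)) \<le> \<bar>x\<bar> * (exp (- a * x) + exp (- b * x))"
      using r exp_between_le[of a r b x] by (auto simp: abs_mult intro!: mult_left_mono)
  qed (use assms in auto)
  then show ?thesis by simp
qed

text \<open>Fatou's lemma: a uniform bound on the integrals passes to the limit.\<close>

lemma integrable_nonneg_limit:
  fixes f :: "nat \<Rightarrow> 'a \<Rightarrow> real"
  assumes "\<And>n. integrable M (f n)" and "\<And>n x. 0 \<le> f n x"
    and lim: "\<And>x. (\<lambda>n. f n x) \<longlonglongrightarrow> g x"
    and bound: "\<And>n. (\<integral>x. f n x \<partial>M) \<le> K"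
  shows "integrable M g"
proof (rule integrableI_nonneg)
  show "g \<in> borel_measurable M"
    using assms by (intro borel_measurable_LIMSEQ_real[OF lim]) auto
  show "AE x in M. 0 \<le> g x"
    using assms by (auto intro!: LIMSEQ_le_const[OF lim])
  have "(\<integral>\<^sup>+x. g x \<partial>M) = (\<integral>\<^sup>+x. liminf (\<lambda>n. ennreal (f n x)) \<partial>M)"
    using lim by (intro nn_integral_cong lim_imp_Liminf[symmetric]) auto
  also have "\<dots> \<le> liminf (\<lambda>n. \<integral>\<^sup>+x. f n x \<partial>M)"
    using assms(1) by (intro nn_integral_liminf) auto
  also have "\<dots> \<le> ennreal K"
    using assms by (intro Liminf_le) (auto simp: nn_integral_eq_integral intro!: always_eventually ennreal_leI)
  also have "\<dots> < \<infinity>" by simp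
  finally show "(\<integral>\<^sup>+x. g x \<partial>M) < \<infinity>" .
qed

text \<open>Ratio test: consecutive terms have a quotient tending to \<open>\<bar>s\<bar>\<close> in
  absolute value, hence eventually below the midpoint of \<open>\<bar>s\<bar>\<close> and 1.\<close>

lemma summable_fact_ratio:
  fixes s :: real
  assumes "\<bar>s\<bar> < 1"
  shows "summable (\<lambda>n. fact (n + k) / fact n * s ^ n)"
proof -
  have "(\<lambda>n. (real n + 1 + real k) / (real n + 1) * \<bar>s\<bar>) \<longlonglongrightarrow> 1 * \<bar>s\<bar>"
    by (intro tendsto_intros) real_asymp
  then have "\<forall>\<^sub>F n in sequentially. (real n + 1 + real k) / (real n + 1) * \<bar>s\<bar> < (1 + \<bar>s\<bar>) / 2"
    by (rule order_tendstoD) (use assms in auto)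
  then obtain N where N: "\<And>n. n \<ge> N \<Longrightarrow>
      (real n + 1 + real k) / (real n + 1) * \<bar>s\<bar> < (1 + \<bar>s\<bar>) / 2"
    by (auto simp: eventually_sequentially)
  show ?thesis
  proof (rule summable_ratio_test[where c = "(1 + \<bar>s\<bar>) / 2" and N = N])
    fix n assume "n \<ge> N"
    have "fact (Suc n + k) / fact (Suc n) * s ^ Suc n
        = ((real n + 1 + real k) / (real n + 1) * s) * (fact (n + k) / fact n * s ^ n)"
      by (simp add: divide_simps) (simp add: algebra_simps)
    then have "norm (fact (Suc n + k) / fact (Suc n) * s ^ Suc n)
        = ((real n + 1 + real k) / (real n + 1) * \<bar>s\<bar>) * norm (fact (n + k) / fact n * s ^ n)"
      by (simp only: norm_mult) simp
    also have "\<dots> \<le> (1 + \<bar>s\<bar>) / 2 * norm (fact (n + k) / fact n * s ^ n)"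
      by (rule mult_right_mono[OF less_imp_le[OF N[OF \<open>n \<ge> N\<close>]]]) simp
    finally show "norm (fact (Suc n + k) / fact (Suc n) * s ^ Suc n)
        \<le> (1 + \<bar>s\<bar>) / 2 * norm (fact (n + k) / fact n * s ^ n)" .
  qed (use assms in simp)
qed

section \<open>Exponential moments and the derivatives of the transform\<close>

text \<open>Both sides of the equivalence force \<open>exp (- X)\<close> to be integrable: the mass
  at 0 on one side, the transform at 1 on the other.\<close>

locale exp_integrable = prob_space M for M :: "'a measure" +
  fixes X :: "'a \<Rightarrow> real"
  assumes X_measurable [measurable]: "X \<in> borel_measurable M"
    and integrable_exp_X: "integrable M (\<lambda>\<omega>. exp (- X \<omega>))"
begin

text \<open>On the open unit interval this is the \<open>k\<close>-th derivative of the transform up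
  to the sign \<open>(-1) ^ k\<close>; at \<open>t = 1\<close> it is \<open>fact k\<close> times the
  Poisson mass at \<open>k\<close>.\<close>

definition exp_moment :: "nat \<Rightarrow> real \<Rightarrow> real" where
  "exp_moment k t = (\<integral>\<omega>. X \<omega> ^ k * exp (- t * X \<omega>) \<partial>M)"

lemma exp_moment_0: "exp_moment 0 = blt M X"
  by (simp add: exp_moment_def blt_def fun_eq_iff)

lemma mixed_poisson_mass_eq: "mixed_poisson_mass M X = (\<lambda>n. exp_moment n 1 / fact n)"
  by (simp add: fun_eq_iff mixed_poisson_mass_def exp_moment_def)

lemma integrable_between:
  assumes "integrable M (\<lambda>\<omega>. X \<omega> ^ k * exp (- a * X \<omega>))"
    and "integrable M (\<lambda>\<omega>. X \<omega> ^ k * exp (- b * X \<omega>))"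
    and "a \<le> t" "t \<le> b"
  shows "integrable M (\<lambda>\<omega>. X \<omega> ^ k * exp (- t * X \<omega>))"
proof (rule Bochner_Integration.integrable_bound)
  show "integrable M (\<lambda>\<omega>. \<bar>X \<omega> ^ k * exp (- a * X \<omega>)\<bar> + \<bar>X \<omega> ^ k * exp (- b * X \<omega>)\<bar>)"
    using assms by auto
  show "AE \<omega> in M. norm (X \<omega> ^ k * exp (- t * X \<omega>))
      \<le> norm (\<bar>X \<omega> ^ k * exp (- a * X \<omega>)\<bar> + \<bar>X \<omega> ^ k * exp (- b * X \<omega>)\<bar>)"
  proof (rule AE_I2)
    fix \<omega>
    show "norm (X \<omega> ^ k * exp (- t * X \<omega>))
      \<le> norm (\<bar>X \<omega> ^ k * exp (- a * X \<omega>)\<bar> + \<bar>X \<omega> ^ k * exp (- b * X \<omega>)\<bar>)"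
      using mult_left_mono[OF exp_between_le[OF assms(3,4), of "X \<omega>"], of "\<bar>X \<omega>\<bar> ^ k"]
      by (simp add: abs_mult power_abs distrib_left)
  qed
qed auto

lemma has_blt_at_unit:
  assumes "t \<in> {0..1}"
  shows "has_blt_at M X t"
  using integrable_between[of 0 0 1 t] assms integrable_exp_X by (simp add: has_blt_at_def)

text \<open>An interior \<open>t\<close> leaves room on both sides: the power of \<open>X\<close> is
  absorbed by \<open>exp (c * \<bar>X\<bar>)\<close>, which shifts the exponent by at most
  \<open>c\<close> and keeps it in the unit interval.\<close>

lemma integrable_exp_moment:
  assumes "0 < t" "t < 1"
  shows "integrable M (\<lambda>\<omega>. X \<omega> ^ k * exp (- t * X \<omega>))"
proof -
  \<comment> \<open>The distance from \<open>t\<close> to the boundary of the unit interval.\<close>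
  define c where "c = min t (1 - t)"
  have c: "0 < c" "c \<le> t" "t + c \<le> 1" using assms by (auto simp: c_def)
  have bound: "\<bar>x ^ k * exp (- t * x)\<bar> \<le> fact k / c ^ k * (2 * (1 + exp (- x)))" for x :: real
  proof -
    have "(c * \<bar>x\<bar>) ^ k / fact k \<le> exp (c * \<bar>x\<bar>)"
      using c by (intro power_over_fact_le_exp) auto
    then have "\<bar>x\<bar> ^ k \<le> fact k / c ^ k * exp (c * \<bar>x\<bar>)"
      using c by (simp add: field_simps)
    then have "\<bar>x\<bar> ^ k * exp (- t * x) \<le> fact k / c ^ k * exp (c * \<bar>x\<bar>) * exp (- t * x)"
      by (rule mult_right_mono) simp
    also have "\<dots> = fact k / c ^ k * exp (c * \<bar>x\<bar> - t * x)"
      by (simp add: mult_exp_exp)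
    finally have pow: "\<bar>x\<bar> ^ k * exp (- t * x) \<le> fact k / c ^ k * exp (c * \<bar>x\<bar> - t * x)" .
    \<comment> \<open>The left side equals the first summand for \<open>x \<ge> 0\<close> and the
      second for \<open>x < 0\<close>.\<close>
    have "exp (c * \<bar>x\<bar> - t * x) \<le> exp (- (t - c) * x) + exp (- (t + c) * x)"
      by (cases "0 \<le> x") (auto simp: algebra_simps)
    also have "\<dots> \<le> 2 * (1 + exp (- x))"
      using exp_between_le[of 0 "t - c" 1 x] exp_between_le[of 0 "t + c" 1 x] c by simp
    finally have "exp (c * \<bar>x\<bar> - t * x) \<le> 2 * (1 + exp (- x))" .
    then have "fact k / c ^ k * exp (c * \<bar>x\<bar> - t * x) \<le> fact k / c ^ k * (2 * (1 + exp (- x)))"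
      by (rule mult_left_mono) (use c in simp)
    with pow show ?thesis
      by (simp add: abs_mult power_abs)
  qed
  show ?thesis
  proof (rule Bochner_Integration.integrable_bound)
    show "integrable M (\<lambda>\<omega>. fact k / c ^ k * (2 * (1 + exp (- X \<omega>))))"
      using integrable_exp_X by auto
    show "AE \<omega> in M. norm (X \<omega> ^ k * exp (- t * X \<omega>))
        \<le> norm (fact k / c ^ k * (2 * (1 + exp (- X \<omega>))))"
      using order_trans[OF bound abs_ge_self] by auto
  qed auto
qed

text \<open>Dominated convergence with the endpoint integrands as majorant. Endpoints are included
  so that limits can later be taken at 0 and at 1.\<close>

lemma continuous_on_exp_moment:
  assumes "integrable M (\<lambda>\<omega>. X \<omega> ^ k * exp (- a * X \<omega>))"
    and "integrable M (\<lambda>\<omega>. X \<omega> ^ k * exp (- b * X \<omega>))"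
  shows "continuous_on {a..b} (exp_moment k)"
  unfolding continuous_on_sequentially
proof (intro allI ballI impI)
  fix u t assume t: "t \<in> {a..b}" and u: "(\<forall>n. u n \<in> {a..b}) \<and> u \<longlonglongrightarrow> t"
  show "(exp_moment k \<circ> u) \<longlonglongrightarrow> exp_moment k t"
    unfolding exp_moment_def comp_def
  proof (rule integral_dominated_convergence)
    show "integrable M (\<lambda>\<omega>. \<bar>X \<omega> ^ k * exp (- a * X \<omega>)\<bar> + \<bar>X \<omega> ^ k * exp (- b * X \<omega>)\<bar>)"
      using assms by auto
    show "AE \<omega> in M. (\<lambda>n. X \<omega> ^ k * exp (- u n * X \<omega>)) \<longlonglongrightarrow> X \<omega> ^ k * exp (- t * X \<omega>)"
      using u by (auto intro!: tendsto_intros)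
    show "AE \<omega> in M. norm (X \<omega> ^ k * exp (- u n * X \<omega>))
        \<le> \<bar>X \<omega> ^ k * exp (- a * X \<omega>)\<bar> + \<bar>X \<omega> ^ k * exp (- b * X \<omega>)\<bar>" for n
    proof (rule AE_I2)
      fix \<omega>
      show "norm (X \<omega> ^ k * exp (- u n * X \<omega>))
        \<le> \<bar>X \<omega> ^ k * exp (- a * X \<omega>)\<bar> + \<bar>X \<omega> ^ k * exp (- b * X \<omega>)\<bar>"
        using mult_left_mono[OF exp_between_le[of a "u n" b "X \<omega>"], of "\<bar>X \<omega>\<bar> ^ k"] u
        by (simp add: abs_mult power_abs distrib_left)
    qed
  qed auto
qed

lemma continuous_on_blt: "continuous_on {0..1} (blt M X)"
  using continuous_on_exp_moment[of 0 0 1] integrable_exp_X by (simp add: exp_moment_0)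

text \<open>Differentiation under the integral: the difference quotients converge pointwise and
  \<open>exp_diff_le\<close> dominates them by moments of order \<open>Suc k\<close>.\<close>

lemma exp_moment_has_derivative:
  assumes "0 < t" "t < 1"
  shows "(exp_moment k has_real_derivative - exp_moment (Suc k) t) (at t)"
proof -
  \<comment> \<open>Points strictly between \<open>t\<close> and the ends 0 and 1, where all moments
    are integrable.\<close>
  define a b where "a = t / 2" and "b = (1 + t) / 2"
  have ab: "0 < a" "a < t" "t < b" "b < 1" using assms by (auto simp: a_def b_def)
  let ?q = "\<lambda>s \<omega>. (X \<omega> ^ k * exp (- s * X \<omega>) - X \<omega> ^ k * exp (- t * X \<omega>)) / (s - t)"
  have lim: "((\<lambda>s. \<integral>\<omega>. ?q s \<omega> \<partial>M) \<longlongrightarrow> (\<integral>\<omega>. - (X \<omega> ^ Suc k * exp (- t * X \<omega>)) \<partial>M))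
      (at t within {a<..<b})"
    unfolding tendsto_at_iff_sequentially
  proof (intro allI impI)
    fix u assume u: "\<forall>n. u n \<in> {a<..<b} - {t}" and "u \<longlonglongrightarrow> t"
    show "((\<lambda>s. \<integral>\<omega>. ?q s \<omega> \<partial>M) \<circ> u) \<longlonglongrightarrow> (\<integral>\<omega>. - (X \<omega> ^ Suc k * exp (- t * X \<omega>)) \<partial>M)"
      unfolding comp_def
    proof (rule integral_dominated_convergence)
      show "integrable M (\<lambda>\<omega>. \<bar>X \<omega> ^ Suc k * exp (- a * X \<omega>)\<bar> + \<bar>X \<omega> ^ Suc k * exp (- b * X \<omega>)\<bar>)"
        using ab by (intro Bochner_Integration.integrable_add integrable_abs integrable_exp_moment) auto
      show "AE \<omega> in M. (\<lambda>n. ?q (u n) \<omega>) \<longlonglongrightarrow> - (X \<omega> ^ Suc k * exp (- t * X \<omega>))"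
      proof (rule AE_I2)
        fix \<omega>
        have "((\<lambda>s. X \<omega> ^ k * exp (- s * X \<omega>)) has_real_derivative
            - (X \<omega> ^ Suc k * exp (- t * X \<omega>))) (at t)"
          by (auto intro!: derivative_eq_intros)
        then have "((\<lambda>s. ?q s \<omega>) \<longlongrightarrow> - (X \<omega> ^ Suc k * exp (- t * X \<omega>))) (at t)"
          by (simp add: has_field_derivative_iff)
        then show "(\<lambda>n. ?q (u n) \<omega>) \<longlonglongrightarrow> - (X \<omega> ^ Suc k * exp (- t * X \<omega>))"
          using u \<open>u \<longlonglongrightarrow> t\<close> by (auto simp: tendsto_at_iff_sequentially comp_def)
      qed
      show "AE \<omega> in M. norm (?q (u n) \<omega>)
          \<le> \<bar>X \<omega> ^ Suc k * exp (- a * X \<omega>)\<bar> + \<bar>X \<omega> ^ Suc k * exp (- b * X \<omega>)\<bar>" for n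
      proof (rule AE_I2)
        fix \<omega>
        let ?B = "\<bar>X \<omega>\<bar> * (exp (- a * X \<omega>) + exp (- b * X \<omega>))"
        have n: "u n \<in> {a..b}" "u n \<noteq> t" using u[rule_format, of n] by auto
        have "norm (?q (u n) \<omega>)
            = \<bar>X \<omega>\<bar> ^ k * (\<bar>exp (- u n * X \<omega>) - exp (- t * X \<omega>)\<bar> / \<bar>u n - t\<bar>)"
          by (simp add: abs_mult power_abs flip: right_diff_distrib)
        also have "\<dots> \<le> \<bar>X \<omega>\<bar> ^ k * ?B"
          using exp_diff_le[OF n(1), of t "X \<omega>"] n(2) ab
          by (intro mult_left_mono) (auto simp: divide_le_eq)
        also have "\<dots> = \<bar>X \<omega> ^ Suc k * exp (- a * X \<omega>)\<bar> + \<bar>X \<omega> ^ Suc k * exp (- b * X \<omega>)\<bar>"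
          by (simp add: abs_mult power_abs algebra_simps)
        finally show "norm (?q (u n) \<omega>)
          \<le> \<bar>X \<omega> ^ Suc k * exp (- a * X \<omega>)\<bar> + \<bar>X \<omega> ^ Suc k * exp (- b * X \<omega>)\<bar>" .
      qed
    qed auto
  qed
  have eq: "(\<integral>\<omega>. ?q s \<omega> \<partial>M) = (exp_moment k s - exp_moment k t) / (s - t)"
    if "s \<in> {a<..<b}" for s
    using that ab integrable_exp_moment[of s k] integrable_exp_moment[of t k]
    unfolding exp_moment_def by simp
  have "\<forall>\<^sub>F s in at t within {a<..<b}.
      (\<integral>\<omega>. ?q s \<omega> \<partial>M) = (exp_moment k s - exp_moment k t) / (s - t)"
    unfolding eventually_at_filter by (intro always_eventually allI impI eq)
  then have "((\<lambda>s. (exp_moment k s - exp_moment k t) / (s - t))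
      \<longlongrightarrow> (\<integral>\<omega>. - (X \<omega> ^ Suc k * exp (- t * X \<omega>)) \<partial>M)) (at t within {a<..<b})"
    by (rule Lim_transform_eventually[OF lim])
  then have "((\<lambda>s. (exp_moment k s - exp_moment k t) / (s - t)) \<longlongrightarrow> - exp_moment (Suc k) t)
      (at t within {a<..<b})"
    by (simp add: exp_moment_def)
  then show ?thesis
    using ab at_within_open[of t "{a<..<b}"] by (simp add: has_field_derivative_iff)
qed

lemma deriv_funpow_blt:
  assumes "t \<in> {0<..<1}"
  shows "(deriv ^^ k) (blt M X) t = (-1) ^ k * exp_moment k t"
  using assms
proof (induction k arbitrary: t)
  case 0
  then show ?case by (simp add: exp_moment_0)
next
  case (Suc k)
  have "((\<lambda>s. (-1) ^ k * exp_moment k s) has_real_derivative (-1) ^ Suc k * exp_moment (Suc k) t)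
      (at t)"
    using DERIV_cmult[OF exp_moment_has_derivative[of t k], of "(-1) ^ k"] Suc.prems by simp
  \<comment> \<open>The induction hypothesis identifies the iterated derivative only on the open
    unit interval, which is a neighbourhood of \<open>t\<close>.\<close>
  then have "((deriv ^^ k) (blt M X) has_real_derivative (-1) ^ Suc k * exp_moment (Suc k) t) (at t)"
    by (rule has_field_derivative_transform_within_open[of _ _ _ "{0<..<1}"])
      (use Suc in auto)
  then show ?case by (simp add: DERIV_imp_deriv)
qed

text \<open>Continuity and differentiability are automatic here and the alternating signs cancel, so
  only the sign of the moments remains.\<close>

lemma completely_monotone_unit_blt_iff:
  "completely_monotone_unit (blt M X) \<longleftrightarrow> (\<forall>k. \<forall>t\<in>{0<..<1}. 0 \<le> exp_moment k t)"
proof -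
  have "(deriv ^^ k) (blt M X) differentiable (at t)" if "t \<in> {0<..<1}" for k t
  proof -
    have "((\<lambda>s. (-1) ^ k * exp_moment k s) has_real_derivative (-1) ^ k * (- exp_moment (Suc k) t)) (at t)"
      using that by (intro DERIV_cmult exp_moment_has_derivative) auto
    then have "((deriv ^^ k) (blt M X) has_real_derivative (-1) ^ k * (- exp_moment (Suc k) t)) (at t)"
      by (rule has_field_derivative_transform_within_open[of _ _ _ "{0<..<1}"])
        (use that in \<open>auto simp: deriv_funpow_blt\<close>)
    then show ?thesis by (auto simp: real_differentiable_def)
  qed
  moreover have "(-1) ^ k * (deriv ^^ k) (blt M X) t = exp_moment k t" if "t \<in> {0<..<1}" for k t
    using that by (simp add: deriv_funpow_blt flip: mult.assoc power_mult_distrib)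
  ultimately show ?thesis
    by (simp add: completely_monotone_unit_def continuous_on_blt)
qed

section \<open>From the mass function to complete monotonicity\<close>

text \<open>Only the even absolute moments are controlled by \<open>exp_moment\<close> directly, as \<open>X\<close> has
  no sign; the odd ones are handled by $|x|^{2j+1} \le x^{2j} + x^{2j+2}$.\<close>
lemma abs_moment_le:
  assumes int: "\<And>n. integrable M (\<lambda>\<omega>. X \<omega> ^ n * exp (- X \<omega>))"
    and le: "\<And>n. exp_moment n 1 \<le> fact n"
  shows "(\<integral>\<omega>. \<bar>X \<omega>\<bar> ^ n * exp (- X \<omega>) \<partial>M) \<le> 2 * fact (Suc n)"
proof (cases "even n")
  case True
  then have "(\<integral>\<omega>. \<bar>X \<omega>\<bar> ^ n * exp (- X \<omega>) \<partial>M) \<le> fact n"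
    using le[of n] by (simp add: exp_moment_def power_even_abs)
  also have "\<dots> \<le> 2 * fact (Suc n)"
    using fact_mono[of n "Suc n", where 'a = real] fact_ge_zero[of "Suc n", where 'a = real] by linarith
  finally show ?thesis .
next
  case False
  then obtain j where j: "n = Suc (2 * j)" by (auto elim: oddE)
  have pow: "\<bar>x\<bar> ^ n \<le> x ^ (2 * j) + x ^ (2 * j + 2)" for x :: real
  proof -
    have "\<bar>x\<bar> \<le> 1 + x\<^sup>2"
      using zero_le_power2[of "\<bar>x\<bar> - 1"] unfolding power2_diff by simp
    then have "\<bar>x\<bar> ^ (2 * j) * \<bar>x\<bar> \<le> \<bar>x\<bar> ^ (2 * j) * (1 + x\<^sup>2)"
      by (rule mult_left_mono) simp
    then show ?thesis
      by (simp add: j power_even_abs power2_eq_square algebra_simps)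
  qed
  have "(\<integral>\<omega>. \<bar>X \<omega>\<bar> ^ n * exp (- X \<omega>) \<partial>M)
      \<le> (\<integral>\<omega>. X \<omega> ^ (2 * j) * exp (- X \<omega>) + X \<omega> ^ (2 * j + 2) * exp (- X \<omega>) \<partial>M)"
  proof (rule integral_mono)
    show "integrable M (\<lambda>\<omega>. \<bar>X \<omega>\<bar> ^ n * exp (- X \<omega>))"
      using integrable_abs[OF int[of n]] by (simp add: abs_mult power_abs)
    show "integrable M (\<lambda>\<omega>. X \<omega> ^ (2 * j) * exp (- X \<omega>) + X \<omega> ^ (2 * j + 2) * exp (- X \<omega>))"
      by (intro Bochner_Integration.integrable_add int)
  qed (use pow in \<open>auto simp flip: distrib_right intro!: mult_right_mono\<close>)
  also have "\<dots> = exp_moment (2 * j) 1 + exp_moment (2 * j + 2) 1"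
    by (subst Bochner_Integration.integral_add[OF int int]) (simp add: exp_moment_def)
  also have "\<dots> \<le> fact (2 * j) + fact (2 * j + 2)"
    by (intro add_mono le)
  also have "\<dots> \<le> 2 * fact (Suc n)"
    using fact_mono[of "2 * j" "2 * j + 2", where 'a = real] by (simp add: j mult.commute)
  finally show ?thesis .
qed

text \<open>Write \<open>exp (- (1 - s) * X)\<close> as \<open>exp (- X) * exp (s * X)\<close>,
  expand the second factor and integrate termwise.\<close>

lemma exp_moment_series:
  assumes int: "\<And>n. integrable M (\<lambda>\<omega>. X \<omega> ^ n * exp (- X \<omega>))"
    and le: "\<And>n. exp_moment n 1 \<le> fact n" and s: "\<bar>s\<bar> < 1"
  shows "(\<lambda>n. exp_moment (n + k) 1 * s ^ n / fact n) sums exp_moment k (1 - s)"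
proof -
  let ?f = "\<lambda>n \<omega>. X \<omega> ^ (n + k) * exp (- X \<omega>) * (s ^ n / fact n)"
  have f_sums: "?f n \<omega> = X \<omega> ^ k * exp (- X \<omega>) * ((s * X \<omega>) ^ n /\<^sub>R fact n)" for n \<omega>
    by (simp add: power_mult_distrib power_add field_simps)
  have "(\<lambda>n. ?f n \<omega>) sums (X \<omega> ^ k * exp (- X \<omega>) * exp (s * X \<omega>))" for \<omega>
    unfolding f_sums by (intro sums_mult exp_converges)
  then have eq: "(\<Sum>n. ?f n \<omega>) = X \<omega> ^ k * exp (- (1 - s) * X \<omega>)" for \<omega>
    by (simp add: sums_iff mult.assoc mult_exp_exp algebra_simps)
  have "(\<lambda>n. integral\<^sup>L M (?f n)) sums (\<integral>\<omega>. (\<Sum>n. ?f n \<omega>) \<partial>M)"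
  proof (rule sums_integral)
    show "integrable M (?f n)" for n
      using int by auto
    show "AE \<omega> in M. summable (\<lambda>n. norm (?f n \<omega>))"
    proof (rule AE_I2)
      fix \<omega>
      have "summable (\<lambda>n. \<bar>X \<omega>\<bar> ^ k * exp (- X \<omega>) * ((\<bar>s\<bar> * \<bar>X \<omega>\<bar>) ^ n /\<^sub>R fact n))"
        by (intro summable_mult summable_exp_generic)
      then show "summable (\<lambda>n. norm (?f n \<omega>))"
        by (simp add: f_sums abs_mult power_abs power_mult_distrib power_add mult_ac divide_inverse)
    qed
    show "summable (\<lambda>n. \<integral>\<omega>. norm (?f n \<omega>) \<partial>M)"
    proof (rule summable_comparison_test')
      \<comment> \<open>The shift is \<open>Suc k\<close> rather than \<open>k\<close> because
        \<open>abs_moment_le\<close> bounds a moment by the next factorial.\<close>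
      show "summable (\<lambda>n. 2 * (fact (n + Suc k) / fact n * \<bar>s\<bar> ^ n))"
        using s by (intro summable_mult summable_fact_ratio) auto
      fix n
      have "norm (\<integral>\<omega>. norm (?f n \<omega>) \<partial>M)
          = (\<integral>\<omega>. \<bar>X \<omega>\<bar> ^ (n + k) * exp (- X \<omega>) \<partial>M) * (\<bar>s\<bar> ^ n / fact n)"
        by (simp add: abs_mult power_abs)
      also have "\<dots> \<le> 2 * fact (Suc (n + k)) * (\<bar>s\<bar> ^ n / fact n)"
        by (intro mult_right_mono abs_moment_le int le) auto
      finally show "norm (\<integral>\<omega>. norm (?f n \<omega>) \<partial>M) \<le> 2 * (fact (n + Suc k) / fact n * \<bar>s\<bar> ^ n)"
        by simp
    qed
  qed
  then show ?thesis
    unfolding eq by (simp add: exp_moment_def)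
qed

text \<open>Nonnegative masses with sum 1 are each at most 1, so \<open>exp_moment_series\<close>
  applies at \<open>s = 1 - t\<close>, and every term of that series is nonnegative.\<close>

lemma exp_moment_nonneg:
  assumes "mixed_poisson_exists M X" and t: "t \<in> {0<..<1}"
  shows "0 \<le> exp_moment k t"
proof -
  have int: "\<And>n. integrable M (\<lambda>\<omega>. X \<omega> ^ n * exp (- X \<omega>))"
    and nonneg: "\<And>n. 0 \<le> exp_moment n 1 / fact n"
    and sums: "(\<lambda>n. exp_moment n 1 / fact n) sums 1"
    using assms(1) by (simp_all add: mixed_poisson_exists_def valid_pmf_def mixed_poisson_mass_eq)
  have "exp_moment n 1 / fact n \<le> 1" for n
    using sum_le_suminf[OF sums_summable[OF sums], of "{n}"] nonneg sums_unique[OF sums] by simp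
  then have "exp_moment n 1 \<le> fact n" for n
    by (simp add: divide_le_eq)
  then have "(\<lambda>n. exp_moment (n + k) 1 * (1 - t) ^ n / fact n) sums exp_moment k (1 - (1 - t))"
    using t by (intro exp_moment_series int) auto
  then have "(\<lambda>n. exp_moment (n + k) 1 * (1 - t) ^ n / fact n) sums exp_moment k t"
    by simp
  then show ?thesis
  proof (rule sums_le[OF _ sums_zero, rotated])
    show "0 \<le> exp_moment (n + k) 1 * (1 - t) ^ n / fact n" for n
      using t mult_nonneg_nonneg[OF nonneg[of "n + k"] fact_ge_zero[of "n + k"]]
      by (intro divide_nonneg_nonneg mult_nonneg_nonneg) auto
  qed
qed

section \<open>From complete monotonicity to the mass function\<close>

text \<open>For odd \<open>k\<close> the nonnegative moment bounds the contribution of \<open>X < 0\<close> by that of \<open>X > 0\<close>,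
  and the latter stays bounded as \<open>t\<close> tends to 1.\<close>
lemma integrable_odd_moment:
  assumes nonneg: "\<And>t. t \<in> {0<..<1} \<Longrightarrow> 0 \<le> exp_moment k t" and "odd k"
  shows "integrable M (\<lambda>\<omega>. \<bar>X \<omega>\<bar> ^ k * exp (- X \<omega>))"
proof -
  \<comment> \<open>The sequence tends to 1 and stays at or above 1/2, so the moment at 1/2 bounds
    the part with \<open>X \<ge> 0\<close> for all \<open>n\<close>.\<close>
  define t :: "nat \<Rightarrow> real" where "t n = 1 - 1 / (real n + 2)" for n
  have t: "1 / 2 \<le> t n" "0 < t n" "t n < 1" for n
    by (auto simp: t_def field_simps)
  have t_lim: "t \<longlonglongrightarrow> 1"
    unfolding t_def by real_asymp
  have int: "integrable M (\<lambda>\<omega>. \<bar>X \<omega>\<bar> ^ k * exp (- s * X \<omega>))" if "0 < s" "s < 1" for s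
    using integrable_abs[OF integrable_exp_moment[OF that, of k]] by (simp add: abs_mult power_abs)
  show ?thesis
  proof (rule integrable_nonneg_limit)
    show "integrable M (\<lambda>\<omega>. \<bar>X \<omega>\<bar> ^ k * exp (- t n * X \<omega>))" for n
      using t by (intro int)
    show "(\<lambda>n. \<bar>X \<omega>\<bar> ^ k * exp (- t n * X \<omega>)) \<longlonglongrightarrow> \<bar>X \<omega>\<bar> ^ k * exp (- X \<omega>)" for \<omega>
      by (rule tendsto_eq_intros t_lim refl | simp)+
    show "(\<integral>\<omega>. \<bar>X \<omega>\<bar> ^ k * exp (- t n * X \<omega>) \<partial>M)
        \<le> (\<integral>\<omega>. 2 * (\<bar>X \<omega>\<bar> ^ k * exp (- (1 / 2) * X \<omega>)) \<partial>M)" for n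
    proof -
      \<comment> \<open>For negative \<open>x\<close> the two summands cancel since \<open>k\<close>
        is odd; otherwise they coincide.\<close>
      have le: "\<bar>x\<bar> ^ k * exp (- t n * x) + x ^ k * exp (- t n * x)
          \<le> 2 * (\<bar>x\<bar> ^ k * exp (- (1 / 2) * x))" for x :: real
      proof (cases "0 \<le> x")
        case True
        then have "exp (- t n * x) \<le> exp (- (1 / 2) * x)"
          using mult_right_mono[OF t(1)[of n] True] by simp
        then show ?thesis using True by (auto intro!: mult_left_mono)
      next
        case False
        then show ?thesis using \<open>odd k\<close>
          by (simp add: power_minus_odd mult_le_0_iff power_le_zero_eq odd_pos)
      qed
      have "(\<integral>\<omega>. \<bar>X \<omega>\<bar> ^ k * exp (- t n * X \<omega>) \<partial>M)
          \<le> (\<integral>\<omega>. \<bar>X \<omega>\<bar> ^ k * exp (- t n * X \<omega>) \<partial>M) + exp_moment k (t n)"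
        using nonneg t by simp
      also have "\<dots> = (\<integral>\<omega>. \<bar>X \<omega>\<bar> ^ k * exp (- t n * X \<omega>) + X \<omega> ^ k * exp (- t n * X \<omega>) \<partial>M)"
        unfolding exp_moment_def
        by (intro Bochner_Integration.integral_add[symmetric] int integrable_exp_moment t)
      also have "\<dots> \<le> (\<integral>\<omega>. 2 * (\<bar>X \<omega>\<bar> ^ k * exp (- (1 / 2) * X \<omega>)) \<partial>M)"
        using le
        by (intro integral_mono Bochner_Integration.integrable_add int integrable_exp_moment t
            integrable_mult_right) auto
      finally show ?thesis .
    qed
  qed auto
qed

text \<open>Odd orders come from \<open>integrable_odd_moment\<close>; an even order is dominated by
  order 0 together with the next odd order.\<close>

lemma integrable_moment_1:
  assumes nonneg: "\<And>k t. t \<in> {0<..<1} \<Longrightarrow> 0 \<le> exp_moment k t"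
  shows "integrable M (\<lambda>\<omega>. X \<omega> ^ k * exp (- X \<omega>))"
proof -
  define m where "m = (if odd k then k else Suc k)"
  have "integrable M (\<lambda>\<omega>. \<bar>X \<omega>\<bar> ^ m * exp (- X \<omega>))"
    using nonneg by (rule integrable_odd_moment) (auto simp: m_def)
  then have int: "integrable M (\<lambda>\<omega>. exp (- X \<omega>) + \<bar>X \<omega>\<bar> ^ m * exp (- X \<omega>))"
    using integrable_exp_X by auto
  have "\<bar>x\<bar> ^ k \<le> 1 + \<bar>x\<bar> ^ m" for x :: real
  proof (cases "\<bar>x\<bar> \<le> 1")
    case True
    then show ?thesis using power_le_one[of "\<bar>x\<bar>" k] by (simp add: add_increasing2)
  next
    case False
    then have "\<bar>x\<bar> ^ k \<le> \<bar>x\<bar> ^ m" by (intro power_increasing) (auto simp: m_def)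
    then show ?thesis by simp
  qed
  then have "norm (X \<omega> ^ k * exp (- X \<omega>)) \<le> norm (exp (- X \<omega>) + \<bar>X \<omega>\<bar> ^ m * exp (- X \<omega>))" for \<omega>
    using mult_right_mono[of "\<bar>X \<omega>\<bar> ^ k" "1 + \<bar>X \<omega>\<bar> ^ m" "exp (- X \<omega>)"]
    by (simp add: abs_mult power_abs distrib_right)
  then have "AE \<omega> in M. norm (X \<omega> ^ k * exp (- X \<omega>)) \<le> norm (exp (- X \<omega>) + \<bar>X \<omega>\<bar> ^ m * exp (- X \<omega>))"
    by (rule AE_I2)
  then show ?thesis
    by (rule Bochner_Integration.integrable_bound[OF int, rotated]) simp
qed

lemma taylor_sum_le:
  assumes nonneg: "\<And>k t. t \<in> {0<..<1} \<Longrightarrow> 0 \<le> exp_moment k t"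
    and "0 < a" "a < c" "c < 1"
  shows "(\<Sum>m<n. exp_moment m c / fact m * (c - a) ^ m) \<le> exp_moment 0 a"
\<comment> \<open>\<open>Taylor_down\<close> requires a positive order.\<close>
proof (cases "n = 0")
  case True
  then show ?thesis using assms by auto
next
  case False
  have sgn: "(-1) ^ m * x / fact m * (a - c) ^ m = x / fact m * (c - a) ^ m" for m and x :: real
  proof -
    have "(-1) ^ m * (a - c) ^ m = (c - a) ^ m" by (simp flip: power_mult_distrib)
    then show ?thesis by (metis (no_types, opaque_lifting) mult.assoc mult.commute times_divide_eq_left)
  qed
  have "\<exists>t. a < t \<and> t < c \<and> exp_moment 0 a =
      (\<Sum>m<n. (-1) ^ m * exp_moment m c / fact m * (a - c) ^ m)
        + (-1) ^ n * exp_moment n t / fact n * (a - c) ^ n"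
  proof (rule Taylor_down)
    show "\<forall>m t. m < n \<and> a \<le> t \<and> t \<le> c \<longrightarrow>
        ((\<lambda>t. (-1) ^ m * exp_moment m t) has_real_derivative (-1) ^ Suc m * exp_moment (Suc m) t) (at t)"
    proof (intro allI impI)
      fix m t assume "m < n \<and> a \<le> t \<and> t \<le> c"
      then show "((\<lambda>t. (-1) ^ m * exp_moment m t) has_real_derivative
          (-1) ^ Suc m * exp_moment (Suc m) t) (at t)"
        using DERIV_cmult[OF exp_moment_has_derivative[of t m], of "(-1) ^ m"] assms(2-4) by simp
    qed
  qed (use False assms(2-4) in auto)
  then obtain t where "a < t" "t < c" and eq: "exp_moment 0 a =
      (\<Sum>m<n. exp_moment m c / fact m * (c - a) ^ m) + exp_moment n t / fact n * (c - a) ^ n"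
    unfolding sgn by blast
  have "0 \<le> exp_moment n t / fact n * (c - a) ^ n"
    using \<open>a < t\<close> \<open>t < c\<close> assms(2-4)
    by (intro mult_nonneg_nonneg divide_nonneg_nonneg nonneg) auto
  then show ?thesis
    unfolding eq by simp
qed

lemma mixed_poisson_existsI:
  assumes nonneg: "\<And>k t. t \<in> {0<..<1} \<Longrightarrow> 0 \<le> exp_moment k t"
  shows "mixed_poisson_exists M X"
proof -
  have int: "integrable M (\<lambda>\<omega>. X \<omega> ^ k * exp (- X \<omega>))" for k
    by (rule integrable_moment_1[OF nonneg])
  define p where "p n = exp_moment n 1 / fact n" for n
  \<comment> \<open>Below 1/2, so that \<open>e n < 1 - e n\<close> and these two points can serve
    as \<open>a\<close> and \<open>c\<close> in \<open>taylor_sum_le\<close>.\<close>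
  define e :: "nat \<Rightarrow> real" where "e n = 1 / (real n + 3)" for n
  have e: "0 < e n" "e n < 1 / 2" for n
    by (auto simp: e_def field_simps)
  have e_lim: "e \<longlonglongrightarrow> 0"
    unfolding e_def by real_asymp
  have lim1: "(\<lambda>n. exp_moment k (1 - e n)) \<longlonglongrightarrow> exp_moment k 1" for k
  proof (rule continuous_on_tendsto_compose[where s = "{1 / 2..1}" and g = "\<lambda>n. 1 - e n"])
    show "continuous_on {1 / 2..1} (exp_moment k)"
      using int[of k] integrable_exp_moment[of "1 / 2" k] by (intro continuous_on_exp_moment) auto
    show "(\<lambda>n. 1 - e n) \<longlonglongrightarrow> 1"
      using tendsto_diff[OF tendsto_const[of 1] e_lim] by simp
    have "1 - e n \<in> {1 / 2..1}" for n
      using e[of n] by auto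
    then show "\<forall>\<^sub>F n in sequentially. 1 - e n \<in> {1 / 2..1}"
      by simp
  qed simp
  have lim0: "(\<lambda>n. exp_moment 0 (e n)) \<longlonglongrightarrow> 1"
  proof -
    have "(\<lambda>n. blt M X (e n)) \<longlonglongrightarrow> blt M X 0"
    proof (rule continuous_on_tendsto_compose[OF continuous_on_blt e_lim])
      have "e n \<in> {0..1}" for n
        using e[of n] by auto
      then show "\<forall>\<^sub>F n in sequentially. e n \<in> {0..1}"
        by simp
    qed simp
    then show ?thesis by (simp add: exp_moment_0 blt_def prob_space)
  qed
  have p_nonneg: "0 \<le> p k" for k
  proof -
    have "0 \<le> exp_moment k (1 - e n)" for n
      using e[of n] by (intro nonneg) auto
    then have "0 \<le> exp_moment k 1"
      by (intro LIMSEQ_le_const[OF lim1]) auto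
    then show ?thesis by (simp add: p_def)
  qed
  \<comment> \<open>In the Taylor bound both points move to the ends of the interval: the weights
    tend to 1 and the right side to the transform at 0, which is 1.\<close>
  have p_sum_le: "(\<Sum>m<n. p m) \<le> 1" for n
  proof (rule LIMSEQ_le)
    have "(\<lambda>j. \<Sum>m<n. exp_moment m (1 - e j) / fact m * (1 - e j - e j) ^ m)
        \<longlonglongrightarrow> (\<Sum>m<n. exp_moment m 1 / fact m * (1 - 0 - 0) ^ m)"
      by (intro tendsto_intros lim1 e_lim) auto
    then show "(\<lambda>j. \<Sum>m<n. exp_moment m (1 - e j) / fact m * (1 - e j - e j) ^ m)
        \<longlonglongrightarrow> (\<Sum>m<n. p m)"
      by (simp add: p_def)
    have "(\<Sum>m<n. exp_moment m (1 - e j) / fact m * (1 - e j - e j) ^ m) \<le> exp_moment 0 (e j)" for j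
      using e[of j] by (intro taylor_sum_le nonneg) auto
    then show "\<exists>N. \<forall>j\<ge>N. (\<Sum>m<n. exp_moment m (1 - e j) / fact m * (1 - e j - e j) ^ m)
        \<le> exp_moment 0 (e j)"
      by blast
  qed (rule lim0)
  have p_summable: "summable p"
    using p_nonneg p_sum_le by (rule summableI_nonneg_bounded)
  have p_le: "p n \<le> 1" for n
    using member_le_sum[of n "{..<Suc n}" p] p_nonneg p_sum_le[of "Suc n"] by simp
  have "suminf p \<le> 1"
    using p_summable p_sum_le by (rule suminf_le_const)
  \<comment> \<open>Abel-type argument: the transform at \<open>e j\<close> is the series of the
    \<open>p n\<close> with weights at most 1, and it tends to 1.\<close>
  moreover have "1 \<le> suminf p"
  proof (rule LIMSEQ_le_const2[OF lim0])
    have "exp_moment 0 (e j) \<le> suminf p" for j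
    proof -
      have "exp_moment n 1 \<le> fact n" for n
        using p_le[of n] by (simp add: p_def divide_le_eq)
      then have "(\<lambda>n. exp_moment (n + 0) 1 * (1 - e j) ^ n / fact n) sums exp_moment 0 (1 - (1 - e j))"
        using e[of j] by (intro exp_moment_series int) auto
      then have "(\<lambda>n. p n * (1 - e j) ^ n) sums exp_moment 0 (e j)"
        by (simp add: p_def)
      then show ?thesis
      proof (rule sums_le[OF _ _ summable_sums[OF p_summable], rotated])
        show "p n * (1 - e j) ^ n \<le> p n" for n
          using e[of j] p_nonneg by (auto intro!: mult_left_le power_le_one)
      qed
    qed
    then show "\<exists>N. \<forall>j\<ge>N. exp_moment 0 (e j) \<le> suminf p" by blast
  qed
  ultimately have "p sums 1"
    using p_summable by (simp add: sums_iff)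
  then show ?thesis
    using int p_nonneg
    by (simp add: mixed_poisson_exists_def valid_pmf_def mixed_poisson_mass_eq flip: p_def)
qed

section \<open>Combining the two directions\<close>

lemma mixed_poisson_exists_iff:
  "mixed_poisson_exists M X \<longleftrightarrow> completely_monotone_unit (blt M X)"
  unfolding completely_monotone_unit_blt_iff
proof (intro iffI allI ballI)
  show "0 \<le> exp_moment k t" if "mixed_poisson_exists M X" "t \<in> {0<..<1}" for k t
    using that by (rule exp_moment_nonneg)
  show "mixed_poisson_exists M X" if "\<forall>k. \<forall>t\<in>{0<..<1}. 0 \<le> exp_moment k t"
    using that by (intro mixed_poisson_existsI) blast
qed

end

theorem proposition3p1:
  fixes M :: "'a measure" and X :: "'a \<Rightarrow> real"
  assumes "prob_space M" and "X \<in> borel_measurable M"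
  shows "mixed_poisson_exists M X \<longleftrightarrow>
    (\<forall>t\<in>{0..1}. has_blt_at M X t) \<and> completely_monotone_unit (blt M X)"
\<comment> \<open>Without this integrability both sides fail, at \<open>n = 0\<close> and at
  \<open>t = 1\<close> respectively.\<close>
proof (cases "integrable M (\<lambda>\<omega>. exp (- X \<omega>))")
  case True
  then interpret exp_integrable M X
    using assms by (simp add: exp_integrable_def exp_integrable_axioms_def)
  show ?thesis
    by (simp add: has_blt_at_unit mixed_poisson_exists_iff)
next
  case False
  have "integrable M (\<lambda>\<omega>. exp (- X \<omega>))" if "mixed_poisson_exists M X"
    using that[unfolded mixed_poisson_exists_def, THEN conjunct1, rule_format, of 0] by simp
  moreover have "\<not> has_blt_at M X 1"
    using False by (simp add: has_blt_at_def)
  ultimately have "\<not> mixed_poisson_exists M X" "\<not> (\<forall>t\<in>{0..1}. has_blt_at M X t)"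
    using False by auto
  then show ?thesis by blast
qed

end
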